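(* Let $1\le p\le\infty$ and let $\Vert\cdot\Vert_p:\mathbb{DR}^n\to\mathbb{DR}$ be the dual continuation of the vector $p$-norm on $\mathbb{R}^n$. For every $\boldsymbol{x}=\boldsymbol{x}_{\rm s}+\boldsymbol{x}_{\rm i}\epsilon\in\mathbb{DR}^n$: $$\Vert\boldsymbol{x}\Vert_1=\Vert\boldsymbol{x}_{\rm s}\Vert_1+\Big(\langle\mathrm{sign}(\boldsymbol{x}_{\rm s}),\boldsymbol{x}_{\rm i}\rangle+\sum_{k\in\mathrm{supp}^c(\boldsymbol{x}_{\rm s})}|x_{\rm i}^k|\Big)\epsilon;$$ for $1<p<\infty$, $$\Vert\boldsymbol{x}\Vert_p=\begin{cases}\Vert\boldsymbol{x}_{\rm s}\Vert_p+\dfrac{\langle|\boldsymbol{x}_{\rm s}|^{p-2}\odot\boldsymbol{x}_{\rm s},\boldsymbol{x}_{\rm i}\rangle}{\Vert\boldsymbol{x}_{\rm s}\Vert_p^{p-1}}\,\epsilon, & \boldsymbol{x}_{\rm s}\ne\boldsymbol{0},\\ \Vert\boldsymbol{x}_{\rm i}\Vert_p\,\epsilon, & \boldsymbol{x}_{\rm s}=\boldsymbol{0};\end{cases}$$ and $$\Vert\boldsymbol{x}\Vert_\infty=\begin{cases}\Vert\boldsymbol{x}_{\rm s}\Vert_\infty+\max\limits_{k\in\mathcal{I}}\big(\mathrm{sign}(x_{\rm s}^k)\,x_{\rm i}^k\big)\,\epsilon, & \boldsymbol{x}_{\rm s}\ne\boldsymbol{0},\\ \Vert\boldsymbol{x}_{\rm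 i}\Vert_\infty\,\epsilon, & \boldsymbol{x}_{\rm s}=\boldsymbol{0}.\end{cases}$$ Here $x_{\rm s}^k,x_{\rm i}^k$ are the $k$-th entries of $\boldsymbol{x}_{\rm s},\boldsymbol{x}_{\rm i}$, $\mathrm{supp}^c(\boldsymbol{x}_{\rm s})=\{k:x_{\rm s}^k=0\}$, and $\mathcal{I}=\{k:|x_{\rm s}^k|=\Vert\boldsymbol{x}_{\rm s}\Vert_\infty\}$.
   Context: Dual numbers: $\mathbb{DR}=\{p_{\rm s}+p_{\rm i}\epsilon: p_{\rm s},p_{\rm i}\in\mathbb{R}\}$ with $\epsilon\neq0$, $\epsilon^2=0$. Dual vectors are written $\boldsymbol{x}=\boldsymbol{x}_{\rm s}+\boldsymbol{x}_{\rm i}\epsilon\in\mathbb{DR}^n$ with $\boldsymbol{x}_{\rm s},\boldsymbol{x}_{\rm i}\in\mathbb{R}^n$. Gâteaux derivative: $\mathcal{D}_u\phi(x)=\lim_{t\downarrow0}\frac{\phi(x+tu)-\phi(x)}{t}$. The dual continuation of a real-valued function $\phi$ on a real space $\mathcal{X}$ is $\tilde\phi(a+b\epsilon)=\phi(a)+\mathcal{D}_b\phi(a)\,\epsilon$ for $a,b\in\mathcal{X}$; the dual continuation of a norm is denoted by the same symbol. The vector $p$-norm on $\mathbb{R}^n$ is $\Vert\boldsymbol{y}\Vert_p=(|y_1|^p+\cdots+|y_n|^p)^{1/p}$ for $1\le p<\infty$ and $\Vert\boldsymbol{y}\Vert_\infty=\max_i|y_i|$. $\mathrm{sign}$ is applied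 entrywise with $\mathrm{sign}(0)=0$; $\odot$ is the entrywise product; $|\boldsymbol{x}_{\rm s}|^{p-2}\odot\boldsymbol{x}_{\rm s}$ has $k$-th entry $|x_{\rm s}^k|^{p-2}x_{\rm s}^k$, understood as $0$ when $x_{\rm s}^k=0$. *)

theory Defs
  imports "HOL-Analysis.Analysis"
begin

section \<open>Dual numbers\<close>

datatype dual_real = Dual (st: real) (inf_part: real)

lemma dual_real_eqI: "st a = st b \<Longrightarrow> inf_part a = inf_part b \<Longrightarrow> a = b"
  by (cases a; cases b) auto

instantiation dual_real :: "{comm_ring_1, real_algebra_1}"
begin

definition zero_dual_real where "0 = Dual 0 0"
definition one_dual_real where "1 = Dual 1 0"
definition plus_dual_real where "a + b = Dual (st a + st b) (inf_part a + inf_part b)"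
definition minus_dual_real where "a - b = Dual (st a - st b) (inf_part a - inf_part b)"
definition uminus_dual_real where "- a = Dual (- st a) (- inf_part a)"
definition times_dual_real where
  "a * b = Dual (st a * st b) (st a * inf_part b + inf_part a * st b)"
definition scaleR_dual_real where "c *\<^sub>R a = Dual (c * st a) (c * inf_part a)"

instance
  by standard
    (simp_all add: zero_dual_real_def one_dual_real_def plus_dual_real_def minus_dual_real_def
      uminus_dual_real_def times_dual_real_def scaleR_dual_real_def algebra_simps)

end

definition eps :: dual_real  (\<open>\<epsilon>\<close>) where
  "\<epsilon> = Dual 0 1"

lemma eps_nonzero: "\<epsilon> \<noteq> 0"
  by (simp add: eps_def zero_dual_real_def)

lemma eps_squared: "\<epsilon>\<^sup>2 = 0"
  by (simp add: eps_def zero_dual_real_def times_dual_real_def power2_eq_square)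

lemma of_real_dual_real: "of_real c = Dual c 0"
  by (simp add: of_real_def scaleR_dual_real_def one_dual_real_def)

lemma dual_real_decomp: "of_real a + of_real b * \<epsilon> = Dual a b"
  by (simp add: of_real_dual_real eps_def plus_dual_real_def times_dual_real_def)

section \<open>Dual vectors\<close>

definition vst :: "dual_real ^ 'n \<Rightarrow> real ^ 'n" where
  "vst x = (\<chi> k. st (x $ k))"

definition vinf :: "dual_real ^ 'n \<Rightarrow> real ^ 'n" where
  "vinf x = (\<chi> k. inf_part (x $ k))"

lemma dual_vec_decomp: "x = (\<chi> k. of_real (vst x $ k) + of_real (vinf x $ k) * \<epsilon>)"
  by (simp add: dual_real_decomp vst_def vinf_def)

section \<open>Gateaux derivative and dual continuation\<close>

definition gateaux_differentiable :: "('a::real_vector \<Rightarrow> real) \<Rightarrow> 'a \<Rightarrow> 'a \<Rightarrow> bool" where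
  "gateaux_differentiable \<phi> x u \<longleftrightarrow>
     (\<exists>D. ((\<lambda>t. (\<phi> (x + t *\<^sub>R u) - \<phi> x) / t) \<longlongrightarrow> D) (at_right 0))"

text \<open>The value is meaningful only where the one-sided limit exists, that is, under
  \<^const>\<open>gateaux_differentiable\<close>.\<close>

definition gateaux_deriv :: "('a::real_vector \<Rightarrow> real) \<Rightarrow> 'a \<Rightarrow> 'a \<Rightarrow> real" where
  "gateaux_deriv \<phi> x u = Lim (at_right 0) (\<lambda>t. (\<phi> (x + t *\<^sub>R u) - \<phi> x) / t)"

text \<open>The value of the dual continuation of \<open>\<phi>\<close> at \<open>a + b\<epsilon>\<close>, as a function of \<open>a\<close> and \<open>b\<close>.\<close>

definition dual_continuation :: "('a::real_vector \<Rightarrow> real) \<Rightarrow> 'a \<Rightarrow> 'a \<Rightarrow> dual_real" where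
  "dual_continuation \<phi> a b = of_real (\<phi> a) + of_real (gateaux_deriv \<phi> a b) * \<epsilon>"

section \<open>The p-norms\<close>

text \<open>Intended for \<open>1 \<le> p \<le> \<infinity>\<close>. Note that \<open>0 powr a = 0\<close> for every real \<open>a\<close>.\<close>

definition pnorm :: "ereal \<Rightarrow> real ^ 'n \<Rightarrow> real" where
  "pnorm p y =
     (if p = \<infinity> then (MAX k. \<bar>y $ k\<bar>)
      else (\<Sum>k\<in>UNIV. \<bar>y $ k\<bar> powr real_of_ereal p) powr (1 / real_of_ereal p))"

definition dual_pnorm :: "ereal \<Rightarrow> dual_real ^ 'n \<Rightarrow> dual_real" where
  "dual_pnorm p x = dual_continuation (pnorm p) (vst x) (vinf x)"

end

theory Submission
  imports Defs
begin

text \<open>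
  Everything reduces to one-sided directional derivatives of the real norms \<open>\<parallel>\<cdot>\<parallel>\<^sub>p\<close> at
  \<open>a = vst x\<close> in direction \<open>b = vinf x\<close>; the dual number then merely packages the value
  and the derivative. Three different mechanisms produce the derivatives.

  At \<open>a = 0\<close> positive homogeneity makes the difference quotient constantly \<open>\<parallel>b\<parallel>\<^sub>p\<close>.

  For \<open>p = 1\<close> and \<open>p = \<infinity>\<close> the norm is piecewise linear: for all sufficiently small
  \<open>t > 0\<close> the equation \<open>\<bar>a\<^sub>k + t b\<^sub>k\<bar> = \<bar>a\<^sub>k\<bar> + t d\<^sub>k\<close> holds exactly, where \<open>d\<^sub>k = sgn a\<^sub>k b\<^sub>k\<close>
  if \<open>a\<^sub>k \<noteq> 0\<close> and \<open>d\<^sub>k = \<bar>b\<^sub>k\<bar>\<close> otherwise (lemma \<open>eventually_abs_affine\<close>). Summing over \<open>k\<close>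
  settles \<open>p = 1\<close>. For \<open>p = \<infinity>\<close>, the entries with \<open>\<bar>a\<^sub>k\<bar> < \<parallel>a\<parallel>\<^sub>\<infinity>\<close> stay below the maximum
  for small \<open>t\<close> by continuity, so only the maximising entries compete, and among them the one
  with the largest slope wins.

  For \<open>1 < p < \<infinity>\<close> the function \<open>\<bar>u\<bar>\<^sup>p\<close> is differentiable even at \<open>u = 0\<close>
  (lemma \<open>has_real_derivative_abs_powr\<close>), and for \<open>a \<noteq> 0\<close> the sum of these powers is positive,
  so the chain rule applies to its \<open>p\<close>-th root.
\<close>

section \<open>One-sided directional derivatives\<close>

definition has_gateaux_deriv ::
  "('a::real_vector \<Rightarrow> real) \<Rightarrow> 'a \<Rightarrow> 'a \<Rightarrow> real \<Rightarrow> bool" where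
  "has_gateaux_deriv \<phi> x u D \<longleftrightarrow>
     ((\<lambda>t. (\<phi> (x + t *\<^sub>R u) - \<phi> x) / t) \<longlongrightarrow> D) (at_right 0)"

lemma has_gateaux_deriv_imp_differentiable:
  "has_gateaux_deriv \<phi> x u D \<Longrightarrow> gateaux_differentiable \<phi> x u"
  unfolding has_gateaux_deriv_def gateaux_differentiable_def by blast

lemma dual_continuation_eqI:
  assumes "has_gateaux_deriv \<phi> x u D"
  shows "dual_continuation \<phi> x u = of_real (\<phi> x) + of_real D * \<epsilon>"
  using assms unfolding has_gateaux_deriv_def dual_continuation_def gateaux_deriv_def
  by (simp add: tendsto_Lim)

lemma has_gateaux_deriv_affine:
  assumes "eventually (\<lambda>t. \<phi> (x + t *\<^sub>R u) = \<phi> x + t * D) (at_right 0)"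
  shows "has_gateaux_deriv \<phi> x u D"
proof -
  have quot: "eventually (\<lambda>t. D = (\<phi> (x + t *\<^sub>R u) - \<phi> x) / t) (at_right 0)"
    using assms eventually_at_right_less[of 0] by eventually_elim simp
  show ?thesis
    unfolding has_gateaux_deriv_def using tendsto_cong[OF quot, of D] by simp
qed

lemma has_gateaux_deriv_DERIV:
  assumes "((\<lambda>t. \<phi> (x + t *\<^sub>R u)) has_real_derivative D) (at 0)"
  shows "has_gateaux_deriv \<phi> x u D"
proof -
  have "((\<lambda>t. (\<phi> (x + t *\<^sub>R u) - \<phi> x) / t) \<longlongrightarrow> D) (at 0)"
    using assms by (simp add: has_field_derivative_iff)
  then show ?thesis
    unfolding has_gateaux_deriv_def by (rule filterlim_mono) (auto intro: at_le)
qed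

section \<open>The two scalar functions behind the norms\<close>

text \<open>As long as \<open>t\<close> is too small for \<open>a + t b\<close> to change sign, the absolute value is affine in
  \<open>t\<close>; if \<open>a = 0\<close> there is no sign to lose and the slope is \<open>\<bar>b\<bar>\<close>.\<close>

lemma eventually_abs_affine:
  fixes a b :: real
  shows "eventually (\<lambda>t. \<bar>a + t * b\<bar> = \<bar>a\<bar> + t * (if a = 0 then \<bar>b\<bar> else sgn a * b)) (at_right 0)"
proof -
  have lim: "((\<lambda>t. a + t * b) \<longlongrightarrow> a) (at_right 0)"
    by (auto intro!: tendsto_eq_intros)
  consider "a = 0" | "a > 0" | "a < 0" by linarith
  then show ?thesis
  proof cases
    case 1
    show ?thesis
      using eventually_at_right_less[of "0::real"] by eventually_elim (simp add: 1 abs_mult)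
  next
    case 2
    show ?thesis
      using order_tendstoD(1)[OF lim 2] by eventually_elim (use 2 in simp)
  next
    case 3
    show ?thesis
      using order_tendstoD(2)[OF lim 3] by eventually_elim (use 3 in simp)
  qed
qed

text \<open>Away from the origin this is the usual power rule. At the origin the difference quotient has
  absolute value \<open>\<bar>h\<bar>\<^sup>p\<^sup>-\<^sup>1\<close>, which vanishes in the limit precisely because \<open>p > 1\<close>.\<close>

lemma has_real_derivative_abs_powr:
  fixes a p :: real
  assumes "1 < p"
  shows "((\<lambda>u. \<bar>u\<bar> powr p) has_real_derivative p * (\<bar>a\<bar> powr (p - 2) * a)) (at a)"
proof (cases "a = 0")
  case True
  have "((\<lambda>h::real. \<bar>h\<bar> powr (p - 1)) \<longlongrightarrow> 0) (at 0)"
    using assms by (auto intro!: tendsto_eq_intros tendsto_zero_powrI[of _ _ _ "p - 1"])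
  moreover have "\<bar>\<bar>h\<bar> powr p / h\<bar> = \<bar>h\<bar> powr (p - 1)" for h :: real
    by (cases "h = 0") (simp_all add: powr_diff)
  ultimately have "((\<lambda>h::real. \<bar>h\<bar> powr p / h) \<longlongrightarrow> 0) (at 0)"
    by (subst tendsto_rabs_zero_iff[symmetric]) simp
  then show ?thesis
    using True by (simp add: has_field_derivative_iff)
next
  case False
  have "(abs has_real_derivative sgn a) (at a)"
  proof (rule has_field_derivative_transform_within[where f = "\<lambda>u. sgn a * u" and d = "\<bar>a\<bar>"])
    show "((*) (sgn a) has_real_derivative sgn a) (at a)"
      by (auto intro!: derivative_eq_intros)
    show "sgn a * u = \<bar>u\<bar>" if "dist u a < \<bar>a\<bar>" for u
      using that by (auto simp: dist_real_def sgn_if)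
  qed (use False in auto)
  then have "((\<lambda>u. \<bar>u\<bar> powr p) has_real_derivative p * \<bar>a\<bar> powr (p - 1) * sgn a) (at a)"
    using DERIV_fun_powr[of abs "sgn a" a p] False by simp
  moreover have "\<bar>a\<bar> powr (p - 1) = \<bar>a\<bar> powr (p - 2) * \<bar>a\<bar>"
    using False powr_add[of "\<bar>a\<bar>" "p - 2" 1] by simp
  ultimately show ?thesis
    by (simp add: mult.assoc abs_mult_sgn)
qed

section \<open>The real p-norms\<close>

lemma pnorm_1: "pnorm 1 y = (\<Sum>k\<in>UNIV. \<bar>y $ k\<bar>)"
  by (simp add: pnorm_def sum_nonneg)

lemma pnorm_ereal:
  "pnorm (ereal p) y = (\<Sum>k\<in>UNIV. \<bar>y $ k\<bar> powr p) powr (1 / p)"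
  by (simp add: pnorm_def)

lemma pnorm_infty: "pnorm \<infinity> y = (MAX k. \<bar>y $ k\<bar>)"
  by (simp add: pnorm_def)

lemma abs_nth_le_pnorm_infty: "\<bar>y $ k\<bar> \<le> pnorm \<infinity> y"
  by (simp add: pnorm_infty)

lemma pnorm_infty_attained: "\<exists>k. \<bar>y $ k\<bar> = pnorm \<infinity> y"
proof -
  have "pnorm \<infinity> y \<in> range (\<lambda>k. \<bar>y $ k\<bar>)"
    unfolding pnorm_infty by (rule Max_in) auto
  then show ?thesis by auto
qed

lemma pnorm_infty_eqI:
  assumes "\<And>k. \<bar>y $ k\<bar> \<le> m" "\<bar>y $ j\<bar> = m"
  shows "pnorm \<infinity> y = m"
  unfolding pnorm_infty by (rule Max_eqI) (use assms in auto)

lemma pnorm_zero: "pnorm p 0 = 0"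
  by (simp add: pnorm_def)

lemma pnorm_scaleR:
  assumes "1 \<le> p" "0 < t"
  shows "pnorm p (t *\<^sub>R y) = t * pnorm p y"
proof (cases p)
  case (real r)
  then have "1 \<le> r" using assms by (simp add: one_ereal_def)
  have "(\<Sum>k\<in>UNIV. \<bar>(t *\<^sub>R y) $ k\<bar> powr r) = t powr r * (\<Sum>k\<in>UNIV. \<bar>y $ k\<bar> powr r)"
    using \<open>0 < t\<close> by (simp add: abs_mult powr_mult sum_distrib_left)
  moreover have "(t powr r) powr (1 / r) = t"
    using \<open>1 \<le> r\<close> \<open>0 < t\<close> by (simp add: powr_powr)
  ultimately show ?thesis
    by (simp add: real pnorm_ereal powr_mult sum_nonneg)
next
  case PInf
  obtain j where "\<bar>y $ j\<bar> = pnorm \<infinity> y"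
    using pnorm_infty_attained by blast
  then have "pnorm \<infinity> (t *\<^sub>R y) = t * pnorm \<infinity> y"
    using \<open>0 < t\<close> by (intro pnorm_infty_eqI[of _ _ j]) (auto simp: abs_mult abs_nth_le_pnorm_infty)
  then show ?thesis by (simp add: PInf)
next
  case MInf
  then show ?thesis using assms by simp
qed

section \<open>Directional derivatives of the p-norms\<close>

lemma has_gateaux_deriv_pnorm_at_zero:
  assumes "1 \<le> p"
  shows "has_gateaux_deriv (pnorm p) 0 b (pnorm p b)"
proof (rule has_gateaux_deriv_affine)
  show "eventually (\<lambda>t. pnorm p (0 + t *\<^sub>R b) = pnorm p 0 + t * pnorm p b) (at_right 0)"
    using eventually_at_right_less[of 0]
    by eventually_elim (simp add: pnorm_zero pnorm_scaleR[OF assms])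
qed

lemma has_gateaux_deriv_pnorm_1:
  fixes a b :: "real ^ 'n"
  shows "has_gateaux_deriv (pnorm 1) a b
    ((\<chi> k. sgn (a $ k)) \<bullet> b + (\<Sum>k\<in>{k. a $ k = 0}. \<bar>b $ k\<bar>))"
proof (rule has_gateaux_deriv_affine)
  define d where "d k = (if a $ k = 0 then \<bar>b $ k\<bar> else sgn (a $ k) * b $ k)" for k
  have "d k = sgn (a $ k) * b $ k + (if a $ k = 0 then \<bar>b $ k\<bar> else 0)" for k
    by (simp add: d_def)
  then have slope: "(\<Sum>k\<in>UNIV. d k) =
      (\<chi> k. sgn (a $ k)) \<bullet> b + (\<Sum>k\<in>{k. a $ k = 0}. \<bar>b $ k\<bar>)"
    by (simp add: inner_vec_def sum.distrib sum.If_cases)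
  have "eventually (\<lambda>t. \<forall>k. \<bar>a $ k + t * b $ k\<bar> = \<bar>a $ k\<bar> + t * d k) (at_right 0)"
    unfolding d_def by (intro eventually_all_finite eventually_abs_affine)
  then have "eventually (\<lambda>t. pnorm 1 (a + t *\<^sub>R b) = pnorm 1 a + t * (\<Sum>k\<in>UNIV. d k)) (at_right 0)"
    by eventually_elim (simp add: pnorm_1 sum.distrib sum_distrib_left)
  then show "eventually (\<lambda>t. pnorm 1 (a + t *\<^sub>R b) = pnorm 1 a +
      t * ((\<chi> k. sgn (a $ k)) \<bullet> b + (\<Sum>k\<in>{k. a $ k = 0}. \<bar>b $ k\<bar>))) (at_right 0)"
    by (simp add: slope)
qed

text \<open>The chain rule gives \<open>S\<^bsup>1/p - 1\<^esup>\<close> times the inner product, where \<open>S\<close> is the sum of the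
  powers; since \<open>\<parallel>a\<parallel>\<^sub>p = S\<^bsup>1/p\<^esup>\<close>, this factor is \<open>1 / \<parallel>a\<parallel>\<^sub>p\<^bsup>p - 1\<^esup>\<close>.\<close>

lemma has_gateaux_deriv_pnorm_ereal:
  fixes a b :: "real ^ 'n"
  assumes "1 < p" "a \<noteq> 0"
  shows "has_gateaux_deriv (pnorm (ereal p)) a b
    (((\<chi> k. \<bar>a $ k\<bar> powr (p - 2) * a $ k) \<bullet> b) / pnorm (ereal p) a powr (p - 1))"
proof (rule has_gateaux_deriv_DERIV)
  define S where "S t = (\<Sum>k\<in>UNIV. \<bar>a $ k + t * b $ k\<bar> powr p)" for t
  define L where "L = (\<chi> k. \<bar>a $ k\<bar> powr (p - 2) * a $ k) \<bullet> b"
  obtain j where "a $ j \<noteq> 0"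
    using \<open>a \<noteq> 0\<close> by (auto simp: vec_eq_iff)
  then have S_pos: "0 < S 0"
    unfolding S_def by (intro sum_pos2[of _ j]) auto
  have "((\<lambda>t. \<bar>a $ k + t * b $ k\<bar> powr p) has_real_derivative
      p * (\<bar>a $ k\<bar> powr (p - 2) * a $ k) * b $ k) (at 0)" for k
  proof -
    have "((\<lambda>t. a $ k + t * b $ k) has_real_derivative b $ k) (at 0)"
      by (auto intro!: derivative_eq_intros)
    from DERIV_chain2[OF _ this] show ?thesis
      using has_real_derivative_abs_powr[OF \<open>1 < p\<close>, of "a $ k"] by simp
  qed
  then have "(S has_real_derivative (\<Sum>k\<in>UNIV. p * (\<bar>a $ k\<bar> powr (p - 2) * a $ k) * b $ k)) (at 0)"
    unfolding S_def by (intro DERIV_sum)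
  then have S_deriv: "(S has_real_derivative p * L) (at 0)"
    by (simp add: L_def inner_vec_def sum_distrib_left mult.assoc)
  have "((\<lambda>t. S t powr (1 / p)) has_real_derivative
      (1 / p) * S 0 powr (1 / p - 1) * (p * L)) (at 0)"
    using DERIV_fun_powr[OF S_deriv S_pos, of "1 / p"] by simp
  moreover have "(1 / p) * S 0 powr (1 / p - 1) * (p * L) = L / (S 0 powr (1 / p)) powr (p - 1)"
  proof -
    have "(1 / p) * (p - 1) = - (1 / p - 1)"
      using \<open>1 < p\<close> by (simp add: field_simps)
    then have "(S 0 powr (1 / p)) powr (p - 1) = S 0 powr (- (1 / p - 1))"
      by (simp only: powr_powr)
    then show ?thesis
      using \<open>1 < p\<close> powr_minus_divide[of "S 0" "- (1 / p - 1)"] by simp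
  qed
  moreover have "pnorm (ereal p) (a + t *\<^sub>R b) = S t powr (1 / p)" for t
    by (simp add: pnorm_ereal S_def)
  moreover have "pnorm (ereal p) a = S 0 powr (1 / p)"
    by (simp add: pnorm_ereal S_def)
  ultimately show "((\<lambda>t. pnorm (ereal p) (a + t *\<^sub>R b)) has_real_derivative
      ((\<chi> k. \<bar>a $ k\<bar> powr (p - 2) * a $ k) \<bullet> b) / pnorm (ereal p) a powr (p - 1)) (at 0)"
    by (simp add: L_def)
qed

text \<open>For small \<open>t > 0\<close> the maximum \<open>\<parallel>a + t b\<parallel>\<^sub>\<infinity>\<close> equals \<open>\<parallel>a\<parallel>\<^sub>\<infinity> + t D\<close>, with \<open>D\<close> the largest slope
  among the maximising entries of \<open>a\<close>: the absolute values of these entries start from the common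
  height \<open>\<parallel>a\<parallel>\<^sub>\<infinity>\<close> and grow with slope at most \<open>D\<close>, and all others start strictly lower.\<close>

lemma has_gateaux_deriv_pnorm_infty:
  fixes a b :: "real ^ 'n"
  assumes "a \<noteq> 0"
  shows "has_gateaux_deriv (pnorm \<infinity>) a b
    (MAX k\<in>{k. \<bar>a $ k\<bar> = pnorm \<infinity> a}. sgn (a $ k) * b $ k)"
proof (rule has_gateaux_deriv_affine)
  define M where "M = pnorm \<infinity> a"
  define I where "I = {k. \<bar>a $ k\<bar> = M}"
  define D where "D = (MAX k\<in>I. sgn (a $ k) * b $ k)"
  obtain i where "a $ i \<noteq> 0"
    using \<open>a \<noteq> 0\<close> by (auto simp: vec_eq_iff)
  then have "0 < M"
    using abs_nth_le_pnorm_infty[of a i] by (simp add: M_def)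
  have "I \<noteq> {}"
    using pnorm_infty_attained[of a] by (auto simp: I_def M_def)
  then have "D \<in> (\<lambda>k. sgn (a $ k) * b $ k) ` I"
    unfolding D_def by (intro Max_in) auto
  then obtain j where j: "j \<in> I" "D = sgn (a $ j) * b $ j"
    by blast
  have D_ge: "sgn (a $ k) * b $ k \<le> D" if "k \<in> I" for k
    unfolding D_def using that by (intro Max_ge) auto
  have on_I: "eventually (\<lambda>t. \<forall>k. k \<in> I \<longrightarrow> \<bar>a $ k + t * b $ k\<bar> = M + t * (sgn (a $ k) * b $ k))
      (at_right 0)"
  proof (intro eventually_all_finite)
    fix k
    show "eventually (\<lambda>t. k \<in> I \<longrightarrow> \<bar>a $ k + t * b $ k\<bar> = M + t * (sgn (a $ k) * b $ k)) (at_right 0)"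
      using eventually_abs_affine[of "a $ k" "b $ k"]
      by eventually_elim (use \<open>0 < M\<close> in \<open>auto simp: I_def\<close>)
  qed
  have off_I: "eventually (\<lambda>t. \<forall>k. k \<notin> I \<longrightarrow> \<bar>a $ k + t * b $ k\<bar> < M + t * D) (at_right 0)"
  proof (intro eventually_all_finite)
    fix k
    show "eventually (\<lambda>t. k \<notin> I \<longrightarrow> \<bar>a $ k + t * b $ k\<bar> < M + t * D) (at_right 0)"
    proof (cases "k \<in> I")
      case False
      have "((\<lambda>t. M + t * D - \<bar>a $ k + t * b $ k\<bar>) \<longlongrightarrow> M - \<bar>a $ k\<bar>) (at_right 0)"
        by (auto intro!: tendsto_eq_intros)
      moreover have "0 < M - \<bar>a $ k\<bar>"
        using False abs_nth_le_pnorm_infty[of a k] by (simp add: I_def M_def)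
      ultimately have "eventually (\<lambda>t. 0 < M + t * D - \<bar>a $ k + t * b $ k\<bar>) (at_right 0)"
        by (rule order_tendstoD(1))
      then show ?thesis by eventually_elim simp
    qed simp
  qed
  have "eventually (\<lambda>t. pnorm \<infinity> (a + t *\<^sub>R b) = M + t * D) (at_right 0)"
    using on_I off_I eventually_at_right_less[of 0]
  proof eventually_elim
    case (elim t)
    show ?case
    proof (rule pnorm_infty_eqI)
      show "\<bar>(a + t *\<^sub>R b) $ j\<bar> = M + t * D"
        using elim(1) j by simp
      show "\<bar>(a + t *\<^sub>R b) $ k\<bar> \<le> M + t * D" for k
      proof (cases "k \<in> I")
        case True
        then show ?thesis using elim(1,3) D_ge[OF True] by simp
      next
        case False
        then show ?thesis using elim(2) by (simp add: less_imp_le)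
      qed
    qed
  qed
  then show "eventually (\<lambda>t. pnorm \<infinity> (a + t *\<^sub>R b) = pnorm \<infinity> a +
      t * (MAX k\<in>{k. \<bar>a $ k\<bar> = pnorm \<infinity> a}. sgn (a $ k) * b $ k)) (at_right 0)"
    by (simp add: M_def I_def D_def)
qed

lemma gateaux_differentiable_pnorm:
  fixes a b :: "real ^ 'n"
  assumes "1 \<le> p"
  shows "gateaux_differentiable (pnorm p) a b"
proof (cases "a = 0")
  case True
  then show ?thesis
    using has_gateaux_deriv_pnorm_at_zero[OF assms] has_gateaux_deriv_imp_differentiable by blast
next
  case False
  consider "p = 1" | "p = \<infinity>" | r where "p = ereal r" "1 < r"
    using assms by (cases p) (auto simp: one_ereal_def order_le_less)
  then show ?thesis
    using has_gateaux_deriv_pnorm_1 has_gateaux_deriv_pnorm_infty[OF False]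
      has_gateaux_deriv_pnorm_ereal[OF _ False]
    by cases (blast intro: has_gateaux_deriv_imp_differentiable)+
qed

section \<open>The dual p-norms\<close>

theorem proposition4p4:
  fixes x :: "dual_real ^ 'n"
  shows
    "(\<forall>p::ereal. 1 \<le> p \<longrightarrow> gateaux_differentiable (pnorm p) (vst x) (vinf x)) \<and>
     dual_pnorm 1 x =
       of_real (pnorm 1 (vst x)) +
       of_real ((\<chi> k. sgn (vst x $ k)) \<bullet> vinf x + (\<Sum>k\<in>{k. vst x $ k = 0}. \<bar>vinf x $ k\<bar>)) * \<epsilon> \<and>
     (\<forall>p::real. 1 < p \<longrightarrow>
       dual_pnorm (ereal p) x =
         (if vst x \<noteq> 0
          then of_real (pnorm (ereal p) (vst x)) +
               of_real (((\<chi> k. \<bar>vst x $ k\<bar> powr (p - 2) * vst x $ k) \<bullet> vinf x)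
                        / pnorm (ereal p) (vst x) powr (p - 1)) * \<epsilon>
          else of_real (pnorm (ereal p) (vinf x)) * \<epsilon>)) \<and>
     dual_pnorm \<infinity> x =
       (if vst x \<noteq> 0
        then of_real (pnorm \<infinity> (vst x)) +
             of_real (MAX k\<in>{k. \<bar>vst x $ k\<bar> = pnorm \<infinity> (vst x)}. sgn (vst x $ k) * vinf x $ k) * \<epsilon>
        else of_real (pnorm \<infinity> (vinf x)) * \<epsilon>)"
proof (intro conjI allI impI)
  fix p :: ereal
  assume "1 \<le> p"
  then show "gateaux_differentiable (pnorm p) (vst x) (vinf x)"
    by (rule gateaux_differentiable_pnorm)
next
  show "dual_pnorm 1 x =
       of_real (pnorm 1 (vst x)) +
       of_real ((\<chi> k. sgn (vst x $ k)) \<bullet> vinf x + (\<Sum>k\<in>{k. vst x $ k = 0}. \<bar>vinf x $ k\<bar>)) * \<epsilon>"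
    unfolding dual_pnorm_def by (rule dual_continuation_eqI[OF has_gateaux_deriv_pnorm_1])
next
  fix p :: real
  assume "1 < p"
  then have "1 \<le> ereal p" by (simp add: one_ereal_def)
  from \<open>1 < p\<close> show "dual_pnorm (ereal p) x =
         (if vst x \<noteq> 0
          then of_real (pnorm (ereal p) (vst x)) +
               of_real (((\<chi> k. \<bar>vst x $ k\<bar> powr (p - 2) * vst x $ k) \<bullet> vinf x)
                        / pnorm (ereal p) (vst x) powr (p - 1)) * \<epsilon>
          else of_real (pnorm (ereal p) (vinf x)) * \<epsilon>)"
    using dual_continuation_eqI[OF has_gateaux_deriv_pnorm_ereal[of p "vst x" "vinf x"]]
      dual_continuation_eqI[OF has_gateaux_deriv_pnorm_at_zero[OF \<open>1 \<le> ereal p\<close>, of "vinf x"]]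
    by (simp add: dual_pnorm_def pnorm_zero)
next
  show "dual_pnorm \<infinity> x =
       (if vst x \<noteq> 0
        then of_real (pnorm \<infinity> (vst x)) +
             of_real (MAX k\<in>{k. \<bar>vst x $ k\<bar> = pnorm \<infinity> (vst x)}. sgn (vst x $ k) * vinf x $ k) * \<epsilon>
        else of_real (pnorm \<infinity> (vinf x)) * \<epsilon>)"
    using dual_continuation_eqI[OF has_gateaux_deriv_pnorm_infty[of "vst x" "vinf x"]]
      dual_continuation_eqI[OF has_gateaux_deriv_pnorm_at_zero[of \<infinity> "vinf x"]]
    by (simp add: dual_pnorm_def pnorm_zero)
qed

end
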